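(* Let $M=\{0,1\}$ be the multiplicative monoid, $\mathbb{K}$ a field, $X$ an associative (not necessarily unital) $\mathbb{K}$-algebra and $\alpha$ a strong partial action of $M$ on the algebra $X$ such that $\operatorname{dom}\alpha_0$ and $\operatorname{im}\alpha_0$ are ideals of $X$. Then $\alpha$ is globalizable in the category of $\mathbb{K}$-algebras if and only if it is globalizable, in the category of semigroups, when regarded as a strong partial action on the underlying multiplicative semigroup of $X$.
   Context: Let $M$ be a monoid with identity $e$. A strong partial action of $M$ on a set $X$ is a family $\alpha=\{\alpha_m:\operatorname{dom}\alpha_m\to X\}_{m\in M}$ of maps with $\operatorname{dom}\alpha_m\subseteq X$ such that: (1) $\operatorname{dom}\alpha_e=X$ and $\alpha_e=\mathrm{id}_X$; (2) $\alpha_m^{-1}(\operatorname{dom}\alpha_n)=\operatorname{dom}\alpha_{nm}\cap\operatorname{dom}\alpha_m$ for all $m,n\in M$; (3) $\alpha_n\circ\alpha_m=\alpha_{nm}$ on $\alpha_m^{-1}(\operatorname{dom}\alpha_n)$ for all $m,n\in M$. It is a global action if $\operatorname{dom}\alpha_m=X$ for all $m$. A strong partial action (global action) of $M$ on a semigroup (resp. $\mathbb{K}$-algebra) $X$ is one on the underlying set such that each $\operatorname{dom}\alpha_m$ is a subsemigroup (resp. subalgebra) of $X$ and each $\alpha_m$ is a semigroup (resp. algebra) homomorphism. Algebras are associative and not necessarily unital. Write $\operatorname{im}\alpha_m=\alpha_m(\operatorname{dom}\alpha_m)$. Ideals are two-sided (ideals of the algebra $X$). Let $\mathcal{C}$ be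 the category of semigroups or of $\mathbb{K}$-algebras. If $\alpha$ is a strong partial action of $M$ on $X\in\mathcal{C}$ and $\beta$ is a global action of $M$ on $Y\in\mathcal{C}$, a morphism $\iota:\alpha\to\beta$ is a morphism $\iota:X\to Y$ of $\mathcal{C}$ with $\beta_m(\iota(x))=\iota(\alpha_m(x))$ for all $m\in M$, $x\in\operatorname{dom}\alpha_m$. A globalization of $\alpha$ in $\mathcal{C}$ is a pair $(\beta,\iota)$, with $\beta$ a global action of $M$ on an object of $\mathcal{C}$ and $\iota:\alpha\to\beta$ a morphism, such that for all $x,y\in X$ and $m\in M$ with $\beta_m(\iota(x))=\iota(y)$ one has $x\in\operatorname{dom}\alpha_m$ and $\alpha_m(x)=y$. $\alpha$ is globalizable in $\mathcal{C}$ if it has a globalization in $\mathcal{C}$. *)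

theory Defs
  imports "HOL-Algebra.Module"
begin

section \<open>Semigroups and non-unital algebras\<close>

text \<open>
  Objects of both categories are HOL-Algebra records. A semigroup is any extension of a
  \<open>monoid\<close> record, of which only the carrier and the multiplication are used, so the underlying
  multiplicative semigroup of an algebra \<open>X\<close> is \<open>X\<close> itself. The field \<open>one\<close> of these records is
  never constrained.
\<close>

locale mult_semigroup =
  fixes S (structure)
  assumes mult_closed: "\<lbrakk>x \<in> carrier S; y \<in> carrier S\<rbrakk> \<Longrightarrow> x \<otimes> y \<in> carrier S"
    and mult_assoc: "\<lbrakk>x \<in> carrier S; y \<in> carrier S; z \<in> carrier S\<rbrakk> \<Longrightarrow>
      (x \<otimes> y) \<otimes> z = x \<otimes> (y \<otimes> z)"

text \<open>The locale \<open>algebra\<close> of HOL-Algebra is about commutative unital algebras.\<close>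

locale nonunital_algebra = K: field K + module K A + mult_semigroup A
  for K and A (structure) +
  assumes mult_distrib_left: "\<lbrakk>x \<in> carrier A; y \<in> carrier A; z \<in> carrier A\<rbrakk> \<Longrightarrow>
      x \<otimes> (y \<oplus> z) = x \<otimes> y \<oplus> x \<otimes> z"
    and mult_distrib_right: "\<lbrakk>x \<in> carrier A; y \<in> carrier A; z \<in> carrier A\<rbrakk> \<Longrightarrow>
      (x \<oplus> y) \<otimes> z = x \<otimes> z \<oplus> y \<otimes> z"
    and smult_mult_left: "\<lbrakk>c \<in> carrier K; x \<in> carrier A; y \<in> carrier A\<rbrakk> \<Longrightarrow>
      (c \<odot> x) \<otimes> y = c \<odot> (x \<otimes> y)"
    and smult_mult_right: "\<lbrakk>c \<in> carrier K; x \<in> carrier A; y \<in> carrier A\<rbrakk> \<Longrightarrow>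
      x \<otimes> (c \<odot> y) = c \<odot> (x \<otimes> y)"

definition subsemigroup :: "'a set \<Rightarrow> ('a, 's) monoid_scheme \<Rightarrow> bool" where
  "subsemigroup H S \<longleftrightarrow>
     H \<subseteq> carrier S \<and> (\<forall>x\<in>H. \<forall>y\<in>H. x \<otimes>\<^bsub>S\<^esub> y \<in> H)"

definition algebra_subalgebra ::
  "('k, 'l) ring_scheme \<Rightarrow> 'a set \<Rightarrow> ('k, 'a, 's) module_scheme \<Rightarrow> bool" where
  "algebra_subalgebra K H A \<longleftrightarrow> submodule H K A \<and> subsemigroup H A"

text \<open>The locale \<open>ideal\<close> of HOL-Algebra requires a unital ring.\<close>

definition algebra_ideal ::
  "('k, 'l) ring_scheme \<Rightarrow> 'a set \<Rightarrow> ('k, 'a, 's) module_scheme \<Rightarrow> bool" where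
  "algebra_ideal K I A \<longleftrightarrow> submodule I K A \<and>
     (\<forall>x\<in>carrier A. \<forall>i\<in>I. x \<otimes>\<^bsub>A\<^esub> i \<in> I \<and> i \<otimes>\<^bsub>A\<^esub> x \<in> I)"

text \<open>For semigroups the morphisms are the elements of \<open>hom\<close>, which does not refer to units.\<close>

definition algebra_hom ::
  "('k, 'l) ring_scheme \<Rightarrow> ('k, 'a, 's) module_scheme \<Rightarrow> ('k, 'b, 't) module_scheme \<Rightarrow>
    ('a \<Rightarrow> 'b) set" where
  "algebra_hom K A B = {h. h \<in> hom A B \<and> h \<in> hom (add_monoid A) (add_monoid B) \<and>
     (\<forall>c\<in>carrier K. \<forall>x\<in>carrier A. h (c \<odot>\<^bsub>A\<^esub> x) = c \<odot>\<^bsub>B\<^esub> h x)}"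


section \<open>Strong partial actions\<close>

text \<open>
  A family of partial maps is given by the domains \<open>D m\<close> and total functions \<open>\<alpha> m\<close>, whose values
  outside \<open>D m\<close> are irrelevant.
\<close>

definition strong_partial_action ::
  "('m, 'p) monoid_scheme \<Rightarrow> 'a set \<Rightarrow> ('m \<Rightarrow> 'a set) \<Rightarrow> ('m \<Rightarrow> 'a \<Rightarrow> 'a) \<Rightarrow> bool" where
  "strong_partial_action M X D \<alpha> \<longleftrightarrow>
     (\<forall>m\<in>carrier M. D m \<subseteq> X \<and> \<alpha> m \<in> D m \<rightarrow> X) \<and>
     D \<one>\<^bsub>M\<^esub> = X \<and> (\<forall>x\<in>X. \<alpha> \<one>\<^bsub>M\<^esub> x = x) \<and>
     (\<forall>m\<in>carrier M. \<forall>n\<in>carrier M.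
        {x \<in> D m. \<alpha> m x \<in> D n} = D (n \<otimes>\<^bsub>M\<^esub> m) \<inter> D m) \<and>
     (\<forall>m\<in>carrier M. \<forall>n\<in>carrier M. \<forall>x\<in>D m. \<alpha> m x \<in> D n \<longrightarrow>
        \<alpha> n (\<alpha> m x) = \<alpha> (n \<otimes>\<^bsub>M\<^esub> m) x)"

definition semigroup_partial_action ::
  "('m, 'p) monoid_scheme \<Rightarrow> ('a, 's) monoid_scheme \<Rightarrow> ('m \<Rightarrow> 'a set) \<Rightarrow> ('m \<Rightarrow> 'a \<Rightarrow> 'a) \<Rightarrow> bool"
  where
  "semigroup_partial_action M X D \<alpha> \<longleftrightarrow>
     mult_semigroup X \<and> strong_partial_action M (carrier X) D \<alpha> \<and>
     (\<forall>m\<in>carrier M. subsemigroup (D m) X \<and> \<alpha> m \<in> hom (X\<lparr>carrier := D m\<rparr>) X)"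

definition algebra_partial_action ::
  "('k, 'l) ring_scheme \<Rightarrow> ('m, 'p) monoid_scheme \<Rightarrow> ('k, 'a, 's) module_scheme \<Rightarrow>
    ('m \<Rightarrow> 'a set) \<Rightarrow> ('m \<Rightarrow> 'a \<Rightarrow> 'a) \<Rightarrow> bool" where
  "algebra_partial_action K M X D \<alpha> \<longleftrightarrow>
     nonunital_algebra K X \<and> strong_partial_action M (carrier X) D \<alpha> \<and>
     (\<forall>m\<in>carrier M. algebra_subalgebra K (D m) X \<and>
        \<alpha> m \<in> algebra_hom K (X\<lparr>carrier := D m\<rparr>) X)"

definition semigroup_global_action ::
  "('m, 'p) monoid_scheme \<Rightarrow> ('a, 's) monoid_scheme \<Rightarrow> ('m \<Rightarrow> 'a \<Rightarrow> 'a) \<Rightarrow> bool" where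
  "semigroup_global_action M Y \<beta> \<longleftrightarrow> semigroup_partial_action M Y (\<lambda>m. carrier Y) \<beta>"

definition algebra_global_action ::
  "('k, 'l) ring_scheme \<Rightarrow> ('m, 'p) monoid_scheme \<Rightarrow> ('k, 'a, 's) module_scheme \<Rightarrow>
    ('m \<Rightarrow> 'a \<Rightarrow> 'a) \<Rightarrow> bool" where
  "algebra_global_action K M Y \<beta> \<longleftrightarrow> algebra_partial_action K M Y (\<lambda>m. carrier Y) \<beta>"

lemma algebra_partial_action_imp_semigroup:
  "algebra_partial_action K M X D \<alpha> \<Longrightarrow> semigroup_partial_action M X D \<alpha>"
  unfolding algebra_partial_action_def semigroup_partial_action_def algebra_subalgebra_def
    algebra_hom_def nonunital_algebra_def by blast


section \<open>Globalizations\<close>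

definition equivariant ::
  "('m, 'p) monoid_scheme \<Rightarrow> ('m \<Rightarrow> 'a set) \<Rightarrow> ('m \<Rightarrow> 'a \<Rightarrow> 'a) \<Rightarrow> ('m \<Rightarrow> 'b \<Rightarrow> 'b) \<Rightarrow>
    ('a \<Rightarrow> 'b) \<Rightarrow> bool" where
  "equivariant M D \<alpha> \<beta> \<iota> \<longleftrightarrow>
     (\<forall>m\<in>carrier M. \<forall>x\<in>D m. \<beta> m (\<iota> x) = \<iota> (\<alpha> m x))"

definition reflects_action ::
  "('m, 'p) monoid_scheme \<Rightarrow> 'a set \<Rightarrow> ('m \<Rightarrow> 'a set) \<Rightarrow> ('m \<Rightarrow> 'a \<Rightarrow> 'a) \<Rightarrow> ('m \<Rightarrow> 'b \<Rightarrow> 'b) \<Rightarrow>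
    ('a \<Rightarrow> 'b) \<Rightarrow> bool" where
  "reflects_action M X D \<alpha> \<beta> \<iota> \<longleftrightarrow>
     (\<forall>x\<in>X. \<forall>y\<in>X. \<forall>m\<in>carrier M. \<beta> m (\<iota> x) = \<iota> y \<longrightarrow> x \<in> D m \<and> \<alpha> m x = y)"

definition semigroup_globalization ::
  "('m, 'p) monoid_scheme \<Rightarrow> ('a, 's) monoid_scheme \<Rightarrow> ('m \<Rightarrow> 'a set) \<Rightarrow> ('m \<Rightarrow> 'a \<Rightarrow> 'a) \<Rightarrow>
    ('b, 't) monoid_scheme \<Rightarrow> ('m \<Rightarrow> 'b \<Rightarrow> 'b) \<Rightarrow> ('a \<Rightarrow> 'b) \<Rightarrow> bool" where
  "semigroup_globalization M X D \<alpha> Y \<beta> \<iota> \<longleftrightarrow>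
     semigroup_global_action M Y \<beta> \<and> \<iota> \<in> hom X Y \<and> equivariant M D \<alpha> \<beta> \<iota> \<and>
     reflects_action M (carrier X) D \<alpha> \<beta> \<iota>"

definition algebra_globalization ::
  "('k, 'l) ring_scheme \<Rightarrow> ('m, 'p) monoid_scheme \<Rightarrow> ('k, 'a, 's) module_scheme \<Rightarrow>
    ('m \<Rightarrow> 'a set) \<Rightarrow> ('m \<Rightarrow> 'a \<Rightarrow> 'a) \<Rightarrow>
    ('k, 'b, 't) module_scheme \<Rightarrow> ('m \<Rightarrow> 'b \<Rightarrow> 'b) \<Rightarrow> ('a \<Rightarrow> 'b) \<Rightarrow> bool" where
  "algebra_globalization K M X D \<alpha> Y \<beta> \<iota> \<longleftrightarrow>
     algebra_global_action K M Y \<beta> \<and> \<iota> \<in> algebra_hom K X Y \<and> equivariant M D \<alpha> \<beta> \<iota> \<and>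
     reflects_action M (carrier X) D \<alpha> \<beta> \<iota>"

text \<open>
  HOL cannot quantify existentially over all types, so globalizability is defined with the carrier
  of the globalization inside one fixed type, large enough to make this no restriction: inside any
  globalization, the subobject generated by the elements \<open>\<beta>\<^sub>m(\<iota>(x))\<close> is again a globalization, and
  each of its elements is determined by the set of terms (below) denoting it. The lemmas
  \<open>semigroup_globalizableI\<close> and \<open>algebra_globalizableI\<close> show that a globalization with carrier in an
  arbitrary type suffices.
\<close>

datatype ('m, 'a) sterm = SGen 'm 'a | SMul "('m, 'a) sterm" "('m, 'a) sterm"

datatype ('m, 'k, 'a) aterm = AGen 'm 'a | AMul "('m, 'k, 'a) aterm" "('m, 'k, 'a) aterm"
  | AAdd "('m, 'k, 'a) aterm" "('m, 'k, 'a) aterm" | ASmul 'k "('m, 'k, 'a) aterm" | AZero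

definition semigroup_globalizable ::
  "('m, 'p) monoid_scheme \<Rightarrow> ('a, 's) monoid_scheme \<Rightarrow> ('m \<Rightarrow> 'a set) \<Rightarrow> ('m \<Rightarrow> 'a \<Rightarrow> 'a) \<Rightarrow> bool"
  where
  "semigroup_globalizable M X D \<alpha> \<longleftrightarrow>
     (\<exists>(Y :: ('m, 'a) sterm set monoid) \<beta> \<iota>. semigroup_globalization M X D \<alpha> Y \<beta> \<iota>)"

definition algebra_globalizable ::
  "('k, 'l) ring_scheme \<Rightarrow> ('m, 'p) monoid_scheme \<Rightarrow> ('k, 'a, 's) module_scheme \<Rightarrow>
    ('m \<Rightarrow> 'a set) \<Rightarrow> ('m \<Rightarrow> 'a \<Rightarrow> 'a) \<Rightarrow> bool" where
  "algebra_globalizable K M X D \<alpha> \<longleftrightarrow>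
     (\<exists>(Y :: ('k, ('m, 'k, 'a) aterm set) module) \<beta> \<iota>. algebra_globalization K M X D \<alpha> Y \<beta> \<iota>)"


subsection \<open>Independence of the chosen type\<close>

lemma semigroup_globalization_restrict_transport:
  fixes Y :: "('b, 't) monoid_scheme" and f :: "'b \<Rightarrow> 'c"
  assumes "monoid M" and gl: "semigroup_globalization M X D \<alpha> Y \<beta> \<iota>"
    and D: "\<And>m. m \<in> carrier M \<Longrightarrow> D m \<subseteq> carrier X \<and> \<alpha> m \<in> D m \<rightarrow> carrier X"
    and Z: "subsemigroup Z Y" "\<And>m z. m \<in> carrier M \<Longrightarrow> z \<in> Z \<Longrightarrow> \<beta> m z \<in> Z"
      "\<And>x. x \<in> carrier X \<Longrightarrow> \<iota> x \<in> Z" and inj: "inj_on f Z"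
  shows "\<exists>(Y' :: 'c monoid) \<beta>' \<iota>'. semigroup_globalization M X D \<alpha> Y' \<beta>' \<iota>'"
proof -
  interpret M: monoid M by fact
  define g where "g = inv_into Z f"
  have gf [simp]: "g (f z) = z" if "z \<in> Z" for z
    using inj that by (simp add: g_def)
  have ff [simp]: "f y = f z \<longleftrightarrow> y = z" if "y \<in> Z" "z \<in> Z" for y z
    using inj that by (auto dest: inj_onD)
  define Y' :: "'c monoid" where
    "Y' = \<lparr>carrier = f ` Z, monoid.mult = (\<lambda>a b. f (g a \<otimes>\<^bsub>Y\<^esub> g b)), one = f \<one>\<^bsub>Y\<^esub>\<rparr>"
  define \<beta>' where "\<beta>' m c = f (\<beta> m (g c))" for m c
  define \<iota>' where "\<iota>' x = f (\<iota> x)" for x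
  have ZY: "z \<in> carrier Y" if "z \<in> Z" for z
    using Z that by (auto simp: subsemigroup_def)
  have Zm [simp]: "y \<otimes>\<^bsub>Y\<^esub> z \<in> Z" if "y \<in> Z" "z \<in> Z" for y z
    using Z that by (auto simp: subsemigroup_def)
  have sY: "mult_semigroup Y" and spa: "strong_partial_action M (carrier Y) (\<lambda>m. carrier Y) \<beta>"
    and bh: "\<And>m. m \<in> carrier M \<Longrightarrow> \<beta> m \<in> hom Y Y" and ih: "\<iota> \<in> hom X Y"
    and eq: "equivariant M D \<alpha> \<beta> \<iota>" and rf: "reflects_action M (carrier X) D \<alpha> \<beta> \<iota>"
    using gl unfolding semigroup_globalization_def semigroup_global_action_def
      semigroup_partial_action_def by auto
  have bm: "\<beta> m (y \<otimes>\<^bsub>Y\<^esub> z) = \<beta> m y \<otimes>\<^bsub>Y\<^esub> \<beta> m z" if "m \<in> carrier M" "y \<in> Z" "z \<in> Z" for m y z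
    using bh[of m] that by (simp add: hom_def ZY)
  have "mult_semigroup Y'"
    by (rule mult_semigroup.intro) (auto simp: Y'_def mult_semigroup.mult_assoc[OF sY] ZY)
  moreover have "strong_partial_action M (carrier Y') (\<lambda>m. carrier Y') \<beta>'"
    using spa unfolding strong_partial_action_def
    by (auto simp: Y'_def \<beta>'_def Z ZY Pi_iff)
  moreover have "\<forall>m\<in>carrier M. subsemigroup (carrier Y') Y' \<and> \<beta>' m \<in> hom (Y'\<lparr>carrier := carrier Y'\<rparr>) Y'"
    by (auto simp: Y'_def \<beta>'_def Z ZY subsemigroup_def hom_def bm)
  moreover have "\<iota>' \<in> hom X Y'"
    using ih by (auto simp: Y'_def \<iota>'_def Z hom_def)
  moreover have "equivariant M D \<alpha> \<beta>' \<iota>'"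
    using eq D by (auto simp: equivariant_def \<beta>'_def \<iota>'_def Z Pi_iff subset_iff)
  moreover have "reflects_action M (carrier X) D \<alpha> \<beta>' \<iota>'"
    using rf D by (auto simp: reflects_action_def \<beta>'_def \<iota>'_def Z)
  ultimately show ?thesis
    unfolding semigroup_globalization_def semigroup_global_action_def semigroup_partial_action_def
    by blast
qed

lemma algebra_globalization_restrict_transport:
  fixes Y :: "('k, 'b, 't) module_scheme" and f :: "'b \<Rightarrow> 'c"
  assumes "monoid M" and gl: "algebra_globalization K M X D \<alpha> Y \<beta> \<iota>"
    and D: "\<And>m. m \<in> carrier M \<Longrightarrow> D m \<subseteq> carrier X \<and> \<alpha> m \<in> D m \<rightarrow> carrier X"
    and Z: "algebra_subalgebra K Z Y" "\<And>m z. m \<in> carrier M \<Longrightarrow> z \<in> Z \<Longrightarrow> \<beta> m z \<in> Z"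
      "\<And>x. x \<in> carrier X \<Longrightarrow> \<iota> x \<in> Z" and inj: "inj_on f Z"
  shows "\<exists>(Y' :: ('k, 'c) module) \<beta>' \<iota>'. algebra_globalization K M X D \<alpha> Y' \<beta>' \<iota>'"
proof -
  interpret M: monoid M by fact
  define g where "g = inv_into Z f"
  have gf [simp]: "g (f z) = z" if "z \<in> Z" for z
    using inj that by (simp add: g_def)
  have ff [simp]: "f y = f z \<longleftrightarrow> y = z" if "y \<in> Z" "z \<in> Z" for y z
    using inj that by (auto dest: inj_onD)
  define Y' :: "('k, 'c) module" where
    "Y' = \<lparr>carrier = f ` Z, monoid.mult = (\<lambda>a b. f (g a \<otimes>\<^bsub>Y\<^esub> g b)), one = f \<one>\<^bsub>Y\<^esub>,
       zero = f \<zero>\<^bsub>Y\<^esub>, add = (\<lambda>a b. f (g a \<oplus>\<^bsub>Y\<^esub> g b)), smult = (\<lambda>c a. f (c \<odot>\<^bsub>Y\<^esub> g a))\<rparr>"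
  define \<beta>' where "\<beta>' m c = f (\<beta> m (g c))" for m c
  define \<iota>' where "\<iota>' x = f (\<iota> x)" for x
  have sub: "submodule Z K Y" "subsemigroup Z Y"
    using Z by (auto simp: algebra_subalgebra_def)
  have aY: "nonunital_algebra K Y" and spa: "strong_partial_action M (carrier Y) (\<lambda>m. carrier Y) \<beta>"
    and bh: "\<And>m. m \<in> carrier M \<Longrightarrow> \<beta> m \<in> algebra_hom K Y Y" and ih: "\<iota> \<in> algebra_hom K X Y"
    and eq: "equivariant M D \<alpha> \<beta> \<iota>" and rf: "reflects_action M (carrier X) D \<alpha> \<beta> \<iota>"
    using gl unfolding algebra_globalization_def algebra_global_action_def
      algebra_partial_action_def by auto
  interpret Y: nonunital_algebra K Y by fact
  interpret Z: submodule Z K Y by fact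
  have ZY [simp]: "z \<in> carrier Y" if "z \<in> Z" for z
    using Z.subset that by auto
  have Zm [simp]: "y \<otimes>\<^bsub>Y\<^esub> z \<in> Z" if "y \<in> Z" "z \<in> Z" for y z
    using sub that by (auto simp: subsemigroup_def)
  have Za [simp]: "y \<oplus>\<^bsub>Y\<^esub> z \<in> Z" if "y \<in> Z" "z \<in> Z" for y z
    using Z.m_closed that by auto
  have Z0 [simp]: "\<zero>\<^bsub>Y\<^esub> \<in> Z"
    using Z.one_closed by auto
  have Zs [simp]: "c \<odot>\<^bsub>Y\<^esub> z \<in> Z" if "c \<in> carrier K" "z \<in> Z" for c z
    using that by auto
  have Zi [simp]: "\<ominus>\<^bsub>Y\<^esub> z \<in> Z" if "z \<in> Z" for z
    using Z.m_inv_closed that by (auto simp: a_inv_def)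
  have bm: "\<beta> m (y \<otimes>\<^bsub>Y\<^esub> z) = \<beta> m y \<otimes>\<^bsub>Y\<^esub> \<beta> m z" "\<beta> m (y \<oplus>\<^bsub>Y\<^esub> z) = \<beta> m y \<oplus>\<^bsub>Y\<^esub> \<beta> m z"
    if "m \<in> carrier M" "y \<in> Z" "z \<in> Z" for m y z
    using bh[of m] that by (simp_all add: algebra_hom_def hom_def)
  have bs: "\<beta> m (c \<odot>\<^bsub>Y\<^esub> y) = c \<odot>\<^bsub>Y\<^esub> \<beta> m y"
    if "m \<in> carrier M" "y \<in> Z" "c \<in> carrier K" for m y c
    using bh[of m] that by (simp_all add: algebra_hom_def)
  have "abelian_group Y'"
  proof (rule abelian_groupI)
    fix x assume "x \<in> carrier Y'"
    then obtain z where "z \<in> Z" "x = f z" by (auto simp: Y'_def)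
    then show "\<exists>y\<in>carrier Y'. y \<oplus>\<^bsub>Y'\<^esub> x = \<zero>\<^bsub>Y'\<^esub>"
      by (intro bexI[of _ "f (\<ominus>\<^bsub>Y\<^esub> z)"]) (simp_all add: Y'_def Y.M.l_neg)
  qed (auto simp: Y'_def Y.M.a_assoc Y.M.a_comm Y.M.a_lcomm)
  then have mod: "module K Y'"
    by (rule moduleI[OF module.axioms(1)[OF nonunital_algebra.axioms(2)[OF aY]]])
       (auto simp: Y'_def Y.smult_l_distr Y.smult_r_distr Y.smult_assoc1)
  have sg: "mult_semigroup Y'"
    by (rule mult_semigroup.intro) (auto simp: Y'_def Y.mult_assoc)
  have "nonunital_algebra K Y'"
    by (intro nonunital_algebra.intro mod sg Y.K.field_axioms nonunital_algebra_axioms.intro)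
       (auto simp: Y'_def Y.mult_distrib_left Y.mult_distrib_right Y.smult_mult_left
         Y.smult_mult_right)
  moreover have "strong_partial_action M (carrier Y') (\<lambda>m. carrier Y') \<beta>'"
    using spa unfolding strong_partial_action_def
    by (auto simp: Y'_def \<beta>'_def Z Pi_iff)
  moreover have "submodule (carrier Y') K Y'"
  proof -
    interpret Y': module K Y' by (fact mod)
    show ?thesis by (rule Y'.submoduleI) auto
  qed
  then have "\<forall>m\<in>carrier M. algebra_subalgebra K (carrier Y') Y' \<and>
      \<beta>' m \<in> algebra_hom K (Y'\<lparr>carrier := carrier Y'\<rparr>) Y'"
    unfolding algebra_subalgebra_def
    by (auto simp: Y'_def \<beta>'_def Z subsemigroup_def hom_def algebra_hom_def bm bs)
  moreover have "\<iota>' \<in> algebra_hom K X Y'"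
    using ih by (auto simp: Y'_def \<iota>'_def Z hom_def algebra_hom_def)
  moreover have "equivariant M D \<alpha> \<beta>' \<iota>'"
    using eq D by (auto simp: equivariant_def \<beta>'_def \<iota>'_def Z Pi_iff subset_iff)
  moreover have "reflects_action M (carrier X) D \<alpha> \<beta>' \<iota>'"
    using rf D by (auto simp: reflects_action_def \<beta>'_def \<iota>'_def Z)
  ultimately show ?thesis
    unfolding algebra_globalization_def algebra_global_action_def algebra_partial_action_def
    by blast
qed

primrec wf_sterm :: "('m, 'p) monoid_scheme \<Rightarrow> 'a set \<Rightarrow> ('m, 'a) sterm \<Rightarrow> bool" where
  "wf_sterm M X (SGen m x) \<longleftrightarrow> m \<in> carrier M \<and> x \<in> X"
| "wf_sterm M X (SMul s t) \<longleftrightarrow> wf_sterm M X s \<and> wf_sterm M X t"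

primrec eval_sterm ::
  "('b, 't) monoid_scheme \<Rightarrow> ('m \<Rightarrow> 'b \<Rightarrow> 'b) \<Rightarrow> ('a \<Rightarrow> 'b) \<Rightarrow> ('m, 'a) sterm \<Rightarrow> 'b" where
  "eval_sterm Y \<beta> \<iota> (SGen m x) = \<beta> m (\<iota> x)"
| "eval_sterm Y \<beta> \<iota> (SMul s t) = eval_sterm Y \<beta> \<iota> s \<otimes>\<^bsub>Y\<^esub> eval_sterm Y \<beta> \<iota> t"

primrec act_sterm :: "('m, 'p) monoid_scheme \<Rightarrow> 'm \<Rightarrow> ('m, 'a) sterm \<Rightarrow> ('m, 'a) sterm" where
  "act_sterm M n (SGen m x) = SGen (n \<otimes>\<^bsub>M\<^esub> m) x"
| "act_sterm M n (SMul s t) = SMul (act_sterm M n s) (act_sterm M n t)"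

primrec wf_aterm ::
  "('k, 'l) ring_scheme \<Rightarrow> ('m, 'p) monoid_scheme \<Rightarrow> 'a set \<Rightarrow> ('m, 'k, 'a) aterm \<Rightarrow> bool" where
  "wf_aterm K M X (AGen m x) \<longleftrightarrow> m \<in> carrier M \<and> x \<in> X"
| "wf_aterm K M X (AMul s t) \<longleftrightarrow> wf_aterm K M X s \<and> wf_aterm K M X t"
| "wf_aterm K M X (AAdd s t) \<longleftrightarrow> wf_aterm K M X s \<and> wf_aterm K M X t"
| "wf_aterm K M X (ASmul c t) \<longleftrightarrow> c \<in> carrier K \<and> wf_aterm K M X t"
| "wf_aterm K M X AZero \<longleftrightarrow> True"

primrec eval_aterm ::
  "('k, 'b, 't) module_scheme \<Rightarrow> ('m \<Rightarrow> 'b \<Rightarrow> 'b) \<Rightarrow> ('a \<Rightarrow> 'b) \<Rightarrow> ('m, 'k, 'a) aterm \<Rightarrow> 'b"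
  where
  "eval_aterm Y \<beta> \<iota> (AGen m x) = \<beta> m (\<iota> x)"
| "eval_aterm Y \<beta> \<iota> (AMul s t) = eval_aterm Y \<beta> \<iota> s \<otimes>\<^bsub>Y\<^esub> eval_aterm Y \<beta> \<iota> t"
| "eval_aterm Y \<beta> \<iota> (AAdd s t) = eval_aterm Y \<beta> \<iota> s \<oplus>\<^bsub>Y\<^esub> eval_aterm Y \<beta> \<iota> t"
| "eval_aterm Y \<beta> \<iota> (ASmul c t) = c \<odot>\<^bsub>Y\<^esub> eval_aterm Y \<beta> \<iota> t"
| "eval_aterm Y \<beta> \<iota> AZero = \<zero>\<^bsub>Y\<^esub>"

primrec act_aterm :: "('m, 'p) monoid_scheme \<Rightarrow> 'm \<Rightarrow> ('m, 'k, 'a) aterm \<Rightarrow> ('m, 'k, 'a) aterm"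
  where
  "act_aterm M n (AGen m x) = AGen (n \<otimes>\<^bsub>M\<^esub> m) x"
| "act_aterm M n (AMul s t) = AMul (act_aterm M n s) (act_aterm M n t)"
| "act_aterm M n (AAdd s t) = AAdd (act_aterm M n s) (act_aterm M n t)"
| "act_aterm M n (ASmul c t) = ASmul c (act_aterm M n t)"
| "act_aterm M n AZero = AZero"

lemma inj_on_fibre: "inj_on (\<lambda>y. {t \<in> W. e t = y}) (e ` W)"
  by (auto simp: inj_on_def)

lemma semigroup_globalizableI:
  fixes M :: "('m, 'p) monoid_scheme" and X :: "('a, 's) monoid_scheme"
    and Y :: "('b, 't) monoid_scheme"
  assumes "monoid M" and pa: "semigroup_partial_action M X D \<alpha>"
    and gl: "semigroup_globalization M X D \<alpha> Y \<beta> \<iota>"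
  shows "semigroup_globalizable M X D \<alpha>"
proof -
  interpret M: monoid M by fact
  define W where "W = {t. wf_sterm M (carrier X) t}"
  let ?e = "eval_sterm Y \<beta> \<iota>"
  have sY: "mult_semigroup Y" and spa: "strong_partial_action M (carrier Y) (\<lambda>m. carrier Y) \<beta>"
    and bh: "\<And>m. m \<in> carrier M \<Longrightarrow> \<beta> m \<in> hom Y Y" and ih: "\<iota> \<in> hom X Y"
    using gl unfolding semigroup_globalization_def semigroup_global_action_def
      semigroup_partial_action_def by auto
  have ic: "\<iota> x \<in> carrier Y" if "x \<in> carrier X" for x
    using ih that by (auto simp: hom_def)
  have bc: "\<beta> m y \<in> carrier Y" if "m \<in> carrier M" "y \<in> carrier Y" for m y
    using bh that by (auto simp: hom_def)
  have ec: "?e t \<in> carrier Y" if "wf_sterm M (carrier X) t" for t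
    using that by (induction t) (auto simp: ic bc mult_semigroup.mult_closed[OF sY])
  have wa: "wf_sterm M (carrier X) (act_sterm M n t)"
    if "wf_sterm M (carrier X) t" "n \<in> carrier M" for n t
    using that by (induction t) auto
  have ea: "?e (act_sterm M n t) = \<beta> n (?e t)"
    if "wf_sterm M (carrier X) t" "n \<in> carrier M" for n t
    using that
  proof (induction t)
    case (SGen m x)
    then show ?case using spa by (auto simp: strong_partial_action_def ic bc)
  next
    case (SMul s t)
    then show ?case using bh[of n] by (auto simp: hom_def ec)
  qed
  have "subsemigroup (?e ` W) Y"
    unfolding subsemigroup_def W_def
  proof (intro conjI ballI)
    fix y z
    assume "y \<in> ?e ` {t. wf_sterm M (carrier X) t}" "z \<in> ?e ` {t. wf_sterm M (carrier X) t}"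
    then obtain s t where "wf_sterm M (carrier X) s" "wf_sterm M (carrier X) t" "y = ?e s" "z = ?e t"
      by auto
    then show "y \<otimes>\<^bsub>Y\<^esub> z \<in> ?e ` {t. wf_sterm M (carrier X) t}"
      by (intro image_eqI[of _ _ "SMul s t"]) auto
  qed (auto simp: ec)
  moreover have "\<beta> m z \<in> ?e ` W" if "m \<in> carrier M" "z \<in> ?e ` W" for m z
    using that ea[symmetric] wa by (auto simp: W_def)
  moreover have "\<iota> x \<in> ?e ` W" if "x \<in> carrier X" for x
    using that spa ic[OF that]
    by (intro image_eqI[of _ _ "SGen \<one>\<^bsub>M\<^esub> x"]) (auto simp: W_def strong_partial_action_def)
  moreover have "\<And>m. m \<in> carrier M \<Longrightarrow> D m \<subseteq> carrier X \<and> \<alpha> m \<in> D m \<rightarrow> carrier X"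
    using pa unfolding semigroup_partial_action_def strong_partial_action_def by blast
  ultimately show ?thesis
    unfolding semigroup_globalizable_def
    using semigroup_globalization_restrict_transport[OF \<open>monoid M\<close> gl, of "?e ` W"] inj_on_fibre[of W ?e]
    by blast
qed

lemma algebra_globalizableI:
  fixes M :: "('m, 'p) monoid_scheme" and X :: "('k, 'a, 's) module_scheme"
    and Y :: "('k, 'b, 't) module_scheme"
  assumes "monoid M" and pa: "algebra_partial_action K M X D \<alpha>"
    and gl: "algebra_globalization K M X D \<alpha> Y \<beta> \<iota>"
  shows "algebra_globalizable K M X D \<alpha>"
proof -
  interpret M: monoid M by fact
  define W where "W = {t. wf_aterm K M (carrier X) t}"
  let ?e = "eval_aterm Y \<beta> \<iota>"
  have aY: "nonunital_algebra K Y" and spa: "strong_partial_action M (carrier Y) (\<lambda>m. carrier Y) \<beta>"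
    and bh: "\<And>m. m \<in> carrier M \<Longrightarrow> \<beta> m \<in> algebra_hom K Y Y" and ih: "\<iota> \<in> algebra_hom K X Y"
    using gl unfolding algebra_globalization_def algebra_global_action_def
      algebra_partial_action_def by auto
  interpret Y: nonunital_algebra K Y by fact
  have ic: "\<iota> x \<in> carrier Y" if "x \<in> carrier X" for x
    using ih that by (auto simp: algebra_hom_def hom_def)
  have bc: "\<beta> m y \<in> carrier Y" if "m \<in> carrier M" "y \<in> carrier Y" for m y
    using bh[OF that(1)] that(2) by (auto simp: algebra_hom_def hom_def)
  have b0: "\<beta> m \<zero>\<^bsub>Y\<^esub> = \<zero>\<^bsub>Y\<^esub>" if "m \<in> carrier M" for m
  proof -
    have "\<beta> m (\<zero>\<^bsub>K\<^esub> \<odot>\<^bsub>Y\<^esub> \<zero>\<^bsub>Y\<^esub>) = \<zero>\<^bsub>K\<^esub> \<odot>\<^bsub>Y\<^esub> \<beta> m \<zero>\<^bsub>Y\<^esub>"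
      using bh[OF that] Y.K.zero_closed Y.M.zero_closed unfolding algebra_hom_def by blast
    then show ?thesis using bc[OF that] by simp
  qed
  have ec: "?e t \<in> carrier Y" if "wf_aterm K M (carrier X) t" for t
    using that by (induction t) (auto simp: ic bc Y.mult_closed)
  have wa: "wf_aterm K M (carrier X) (act_aterm M n t)"
    if "wf_aterm K M (carrier X) t" "n \<in> carrier M" for n t
    using that by (induction t) auto
  have ea: "?e (act_aterm M n t) = \<beta> n (?e t)"
    if "wf_aterm K M (carrier X) t" "n \<in> carrier M" for n t
    using that
  proof (induction t)
    case (AGen m x)
    then show ?case using spa by (auto simp: strong_partial_action_def ic bc)
  qed (use bh[of n] in \<open>auto simp: algebra_hom_def hom_def ec b0\<close>)
  have neg: "\<ominus>\<^bsub>Y\<^esub> y = (\<ominus>\<^bsub>K\<^esub> \<one>\<^bsub>K\<^esub>) \<odot>\<^bsub>Y\<^esub> y" if "y \<in> carrier Y" for y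
    using that by (simp add: Y.smult_l_minus)
  have "algebra_subalgebra K (?e ` W) Y"
    unfolding algebra_subalgebra_def
  proof
    show "submodule (?e ` W) K Y"
    proof (rule Y.submoduleI)
      show "?e ` W \<subseteq> carrier Y" by (auto simp: W_def ec)
      show "\<zero>\<^bsub>Y\<^esub> \<in> ?e ` W" by (intro image_eqI[of _ _ AZero]) (auto simp: W_def)
    next
      fix y assume "y \<in> ?e ` W"
      then obtain t where "wf_aterm K M (carrier X) t" "y = ?e t" by (auto simp: W_def)
      then show "\<ominus>\<^bsub>Y\<^esub> y \<in> ?e ` W"
        by (intro image_eqI[of _ _ "ASmul (\<ominus>\<^bsub>K\<^esub> \<one>\<^bsub>K\<^esub>) t"]) (auto simp: W_def neg ec)
    next
      fix y z assume "y \<in> ?e ` W" "z \<in> ?e ` W"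
      then obtain s t where "wf_aterm K M (carrier X) s" "y = ?e s"
        "wf_aterm K M (carrier X) t" "z = ?e t" by (auto simp: W_def)
      then show "y \<oplus>\<^bsub>Y\<^esub> z \<in> ?e ` W"
        by (intro image_eqI[of _ _ "AAdd s t"]) (auto simp: W_def)
    next
      fix c y assume "c \<in> carrier K" "y \<in> ?e ` W"
      then obtain t where "wf_aterm K M (carrier X) t" "y = ?e t" by (auto simp: W_def)
      then show "c \<odot>\<^bsub>Y\<^esub> y \<in> ?e ` W"
        using \<open>c \<in> carrier K\<close> by (intro image_eqI[of _ _ "ASmul c t"]) (auto simp: W_def)
    qed
    show "subsemigroup (?e ` W) Y"
      unfolding subsemigroup_def
    proof (intro conjI ballI)
      fix y z assume "y \<in> ?e ` W" "z \<in> ?e ` W"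
      then obtain s t where "wf_aterm K M (carrier X) s" "y = ?e s"
        "wf_aterm K M (carrier X) t" "z = ?e t" by (auto simp: W_def)
      then show "y \<otimes>\<^bsub>Y\<^esub> z \<in> ?e ` W"
        by (intro image_eqI[of _ _ "AMul s t"]) (auto simp: W_def)
    qed (auto simp: W_def ec)
  qed
  moreover have "\<beta> m z \<in> ?e ` W" if "m \<in> carrier M" "z \<in> ?e ` W" for m z
    using that ea[symmetric] wa by (auto simp: W_def)
  moreover have "\<iota> x \<in> ?e ` W" if "x \<in> carrier X" for x
    using that spa ic[OF that]
    by (intro image_eqI[of _ _ "AGen \<one>\<^bsub>M\<^esub> x"]) (auto simp: W_def strong_partial_action_def)
  moreover have "\<And>m. m \<in> carrier M \<Longrightarrow> D m \<subseteq> carrier X \<and> \<alpha> m \<in> D m \<rightarrow> carrier X"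
    using pa unfolding algebra_partial_action_def strong_partial_action_def by blast
  ultimately show ?thesis
    unfolding algebra_globalizable_def
    using algebra_globalization_restrict_transport[OF \<open>monoid M\<close> gl, of "?e ` W"] inj_on_fibre[of W ?e]
    by blast
qed


section \<open>The monoid $\{0, 1\}$\<close>

definition zero_one_monoid :: "nat monoid" where
  "zero_one_monoid = \<lparr>carrier = {0, 1}, monoid.mult = (*), one = 1\<rparr>"

lemma monoid_zero_one_monoid: "monoid zero_one_monoid"
  by (rule monoidI) (auto simp: zero_one_monoid_def)

end

theory Submission
  imports Defs "HOL-Algebra.AbelCoset"
begin

text \<open>
  Let \<open>I\<close> be the image and \<open>N\<close> the kernel of \<open>\<alpha>\<^sub>0\<close>; as \<open>\<alpha>\<^sub>0\<close> is idempotent,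
  \<open>dom \<alpha>\<^sub>0 = I \<oplus> N\<close>. In any semigroup globalization, the product of \<open>\<beta>\<^sub>0(\<iota>(x))\<close> with
  \<open>\<beta>\<^sub>0(\<iota>(k)) = \<iota>(0) = \<beta>\<^sub>0(\<iota>(0))\<close>, for \<open>k \<in> N\<close>, shows that \<open>\<alpha>\<^sub>0(xk) = \<alpha>\<^sub>0(x0) = 0\<close>; so \<open>N\<close> is an
  ideal of \<open>X\<close>. Conversely, once \<open>N\<close> is an ideal, \<open>x \<mapsto> (x + N, x + I)\<close> into the product algebra
  \<open>X/N \<times> X/I\<close>, on which \<open>0\<close> acts by \<open>(a, b) \<mapsto> (a, 0)\<close>, is an algebra globalization:
  \<open>(x + N, I) = (y + N, y + I)\<close> says that \<open>y \<in> I\<close> and \<open>x - y \<in> N\<close>, that is, \<open>x \<in> dom \<alpha>\<^sub>0\<close> and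
  \<open>\<alpha>\<^sub>0(x) = y\<close>.
\<close>

section \<open>Quotients and products of algebras\<close>

text \<open>The zero vector is the zero scalar times itself, and scalars move across the
  product.\<close>

lemma (in nonunital_algebra) mult_zero:
  assumes "x \<in> carrier A"
  shows "\<zero> \<otimes> x = \<zero>" "x \<otimes> \<zero> = \<zero>"
  using smult_mult_left[of "\<zero>\<^bsub>K\<^esub>" \<zero> x] smult_mult_right[of "\<zero>\<^bsub>K\<^esub>" x \<zero>] assms
  by (simp_all add: mult_closed)

text \<open>Apart from closure and the existence of negatives, the axioms are equations, so they
  pass along a surjection that respects the operations. For quotients this leaves only the
  compatibility of the coset map to check.\<close>

lemma (in nonunital_algebra) surj_image_nonunital_algebra:
  fixes B (structure)
  assumes surj: "carrier B = h ` carrier A"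
    and hom: "\<And>x y. x \<in> carrier A \<Longrightarrow> y \<in> carrier A \<Longrightarrow> h x \<otimes>\<^bsub>B\<^esub> h y = h (x \<otimes> y)"
      "\<And>x y. x \<in> carrier A \<Longrightarrow> y \<in> carrier A \<Longrightarrow> h x \<oplus>\<^bsub>B\<^esub> h y = h (x \<oplus> y)"
      "\<And>c x. c \<in> carrier K \<Longrightarrow> x \<in> carrier A \<Longrightarrow> c \<odot>\<^bsub>B\<^esub> h x = h (c \<odot> x)"
      "\<zero>\<^bsub>B\<^esub> = h \<zero>"
  shows "nonunital_algebra K B"
proof -
  have "abelian_group B"
  proof (rule abelian_groupI)
    fix y assume "y \<in> carrier B"
    then obtain x where "x \<in> carrier A" "y = h x" by (auto simp: surj)
    then show "\<exists>z\<in>carrier B. z \<oplus>\<^bsub>B\<^esub> y = \<zero>\<^bsub>B\<^esub>"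
      by (intro bexI[of _ "h (\<ominus> x)"]) (simp_all add: surj hom M.l_neg)
  qed (auto simp: surj hom M.a_assoc M.a_comm M.a_lcomm)
  then have "module K B"
    by (rule moduleI[OF K.is_cring])
       (auto simp: surj hom smult_l_distr smult_r_distr smult_assoc1)
  moreover have "mult_semigroup B"
    by (rule mult_semigroup.intro) (auto simp: surj hom mult_assoc mult_closed)
  ultimately show ?thesis
    by (intro nonunital_algebra.intro K.field_axioms nonunital_algebra_axioms.intro)
       (auto simp: surj hom mult_closed mult_distrib_left mult_distrib_right smult_mult_left
         smult_mult_right)
qed

section \<open>The quotient of an algebra by an ideal\<close>

text \<open>The product and the scalar multiple are unions over all representatives, which avoids a
  choice; for an ideal \<open>N\<close> all the cosets united are equal.\<close>

definition quotient_algebra ::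
  "('k, 'a, 's) module_scheme \<Rightarrow> 'a set \<Rightarrow> ('k, 'a set) module" where
  "quotient_algebra A N = \<lparr>carrier = a_rcosets\<^bsub>A\<^esub> N,
     monoid.mult = (\<lambda>P Q. \<Union>a\<in>P. \<Union>b\<in>Q. N +>\<^bsub>A\<^esub> (a \<otimes>\<^bsub>A\<^esub> b)), one = N +>\<^bsub>A\<^esub> \<one>\<^bsub>A\<^esub>,
     zero = N, add = set_add A, smult = (\<lambda>c P. \<Union>a\<in>P. N +>\<^bsub>A\<^esub> (c \<odot>\<^bsub>A\<^esub> a))\<rparr>"

context
  fixes K :: "('k, 'l) ring_scheme" and A :: "('k, 'a, 's) module_scheme" and N :: "'a set"
  assumes alg: "nonunital_algebra K A" and ideal: "algebra_ideal K N A"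
begin

interpretation nonunital_algebra K A by (fact alg)

interpretation N: submodule N K A
  using ideal by (simp add: algebra_ideal_def)

interpretation N: abelian_subgroup N A
  by (intro abelian_subgroupI3 additive_subgroup.intro N.subgroup_axioms M.abelian_group_axioms)

lemma coset_eq_iff:
  assumes "x \<in> carrier A" "y \<in> carrier A"
  shows "N +>\<^bsub>A\<^esub> x = N +>\<^bsub>A\<^esub> y \<longleftrightarrow> x \<ominus>\<^bsub>A\<^esub> y \<in> N"
proof
  assume "N +>\<^bsub>A\<^esub> x = N +>\<^bsub>A\<^esub> y"
  then have "x \<in> N +>\<^bsub>A\<^esub> y" using N.a_rcos_self[OF assms(1)] by simp
  then show "x \<ominus>\<^bsub>A\<^esub> y \<in> N"
    using N.a_rcos_module[OF assms(2,1)] by (simp add: a_minus_def)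
next
  assume "x \<ominus>\<^bsub>A\<^esub> y \<in> N"
  then have "x \<in> N +>\<^bsub>A\<^esub> y"
    using N.a_rcos_module[OF assms(2,1)] by (simp add: a_minus_def)
  then show "N +>\<^bsub>A\<^esub> x = N +>\<^bsub>A\<^esub> y"
    using N.a_repr_independence' assms(2) by simp
qed

lemma coset_zero: "N +>\<^bsub>A\<^esub> \<zero>\<^bsub>A\<^esub> = N"
  by (rule M.a_coset_add_zero[OF N.a_subset])

lemma coset_eq_ideal_iff:
  assumes "x \<in> carrier A"
  shows "N +>\<^bsub>A\<^esub> x = N \<longleftrightarrow> x \<in> N"
  using M.a_coset_join1[OF _ assms N.a_subgroup] M.a_coset_join2[OF assms N.a_subgroup] by blast

lemma coset_mem:
  assumes "x \<in> carrier A" "a \<in> N +>\<^bsub>A\<^esub> x"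
  obtains n where "n \<in> N" "n \<in> carrier A" "a = x \<oplus>\<^bsub>A\<^esub> n"
  using assms N.a_subset by (auto simp: a_r_coset_def' M.a_comm)

lemma quotient_mult:
  assumes x: "x \<in> carrier A" and y: "y \<in> carrier A"
  shows "(N +>\<^bsub>A\<^esub> x) \<otimes>\<^bsub>quotient_algebra A N\<^esub> (N +>\<^bsub>A\<^esub> y) = N +>\<^bsub>A\<^esub> (x \<otimes>\<^bsub>A\<^esub> y)"
proof -
  have "N +>\<^bsub>A\<^esub> (a \<otimes>\<^bsub>A\<^esub> b) = N +>\<^bsub>A\<^esub> (x \<otimes>\<^bsub>A\<^esub> y)"
    if a: "a \<in> N +>\<^bsub>A\<^esub> x" and b: "b \<in> N +>\<^bsub>A\<^esub> y" for a b
  proof -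
    obtain m where m: "m \<in> N" "m \<in> carrier A" "a = x \<oplus>\<^bsub>A\<^esub> m" by (rule coset_mem[OF x a])
    obtain n where n: "n \<in> N" "n \<in> carrier A" "b = y \<oplus>\<^bsub>A\<^esub> n" by (rule coset_mem[OF y b])
    \<comment> \<open>These are the terms of \<open>(x + m)(y + n)\<close> other than
      \<open>xy\<close>. Each has a factor in \<open>N\<close>, so their sum is in
      \<open>N\<close>.\<close>
    let ?r = "x \<otimes>\<^bsub>A\<^esub> n \<oplus>\<^bsub>A\<^esub> (m \<otimes>\<^bsub>A\<^esub> y \<oplus>\<^bsub>A\<^esub> m \<otimes>\<^bsub>A\<^esub> n)"
    have r: "?r \<in> N"
      using ideal m n x y by (auto simp: algebra_ideal_def intro!: N.a_closed)
    have "a \<otimes>\<^bsub>A\<^esub> b = ?r \<oplus>\<^bsub>A\<^esub> x \<otimes>\<^bsub>A\<^esub> y"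
      using x y m n by (simp add: mult_distrib_left mult_distrib_right mult_closed M.a_ac)
    then have "a \<otimes>\<^bsub>A\<^esub> b \<in> N +>\<^bsub>A\<^esub> (x \<otimes>\<^bsub>A\<^esub> y)"
      using r by (auto simp: a_r_coset_def')
    then show ?thesis
      using N.a_repr_independence' x y mult_closed by metis
  qed
  then have "(\<Union>a\<in>N +>\<^bsub>A\<^esub> x. \<Union>b\<in>N +>\<^bsub>A\<^esub> y. N +>\<^bsub>A\<^esub> (a \<otimes>\<^bsub>A\<^esub> b)) =
      (\<Union>a\<in>N +>\<^bsub>A\<^esub> x. \<Union>b\<in>N +>\<^bsub>A\<^esub> y. N +>\<^bsub>A\<^esub> (x \<otimes>\<^bsub>A\<^esub> y))"
    by (intro SUP_cong refl)
  also have "\<dots> = N +>\<^bsub>A\<^esub> (x \<otimes>\<^bsub>A\<^esub> y)"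
    \<comment> \<open>A union of a constant family is that constant only over nonempty index sets;
      here \<open>x\<close> and \<open>y\<close> lie in their own cosets.\<close>
    using N.a_rcos_self[OF x] N.a_rcos_self[OF y] by auto
  finally show ?thesis by (simp add: quotient_algebra_def)
qed

lemma quotient_smult:
  assumes c: "c \<in> carrier K" and x: "x \<in> carrier A"
  shows "c \<odot>\<^bsub>quotient_algebra A N\<^esub> (N +>\<^bsub>A\<^esub> x) = N +>\<^bsub>A\<^esub> (c \<odot>\<^bsub>A\<^esub> x)"
proof -
  have "N +>\<^bsub>A\<^esub> (c \<odot>\<^bsub>A\<^esub> a) = N +>\<^bsub>A\<^esub> (c \<odot>\<^bsub>A\<^esub> x)" if a: "a \<in> N +>\<^bsub>A\<^esub> x" for a
  proof -
    obtain n where n: "n \<in> N" "n \<in> carrier A" "a = x \<oplus>\<^bsub>A\<^esub> n" by (rule coset_mem[OF x a])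
    have "c \<odot>\<^bsub>A\<^esub> a = c \<odot>\<^bsub>A\<^esub> n \<oplus>\<^bsub>A\<^esub> c \<odot>\<^bsub>A\<^esub> x"
      using c x n by (simp add: smult_r_distr M.a_comm)
    then have "c \<odot>\<^bsub>A\<^esub> a \<in> N +>\<^bsub>A\<^esub> (c \<odot>\<^bsub>A\<^esub> x)"
      using c n by (auto simp: a_r_coset_def')
    then show ?thesis
      using N.a_repr_independence' c x smult_closed by metis
  qed
  then have "(\<Union>a\<in>N +>\<^bsub>A\<^esub> x. N +>\<^bsub>A\<^esub> (c \<odot>\<^bsub>A\<^esub> a)) = (\<Union>a\<in>N +>\<^bsub>A\<^esub> x. N +>\<^bsub>A\<^esub> (c \<odot>\<^bsub>A\<^esub> x))"
    by (intro SUP_cong refl)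
  also have "\<dots> = N +>\<^bsub>A\<^esub> (c \<odot>\<^bsub>A\<^esub> x)"
    using N.a_rcos_self[OF x] by auto
  finally show ?thesis by (simp add: quotient_algebra_def)
qed

lemma quotient_add:
  assumes "x \<in> carrier A" "y \<in> carrier A"
  shows "(N +>\<^bsub>A\<^esub> x) \<oplus>\<^bsub>quotient_algebra A N\<^esub> (N +>\<^bsub>A\<^esub> y) = N +>\<^bsub>A\<^esub> (x \<oplus>\<^bsub>A\<^esub> y)"
  using assms by (simp add: quotient_algebra_def N.a_rcos_sum)

lemma carrier_quotient: "carrier (quotient_algebra A N) = (\<lambda>x. N +>\<^bsub>A\<^esub> x) ` carrier A"
  by (auto simp: quotient_algebra_def A_RCOSETS_def')

lemma nonunital_algebra_quotient: "nonunital_algebra K (quotient_algebra A N)"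
  by (rule surj_image_nonunital_algebra[where h = "\<lambda>x. N +>\<^bsub>A\<^esub> x"])
     (simp_all add: carrier_quotient quotient_mult quotient_add quotient_smult,
      simp add: quotient_algebra_def coset_zero)

lemma coset_algebra_hom: "(\<lambda>x. N +>\<^bsub>A\<^esub> x) \<in> algebra_hom K A (quotient_algebra A N)"
  by (auto simp: algebra_hom_def hom_def carrier_quotient quotient_mult quotient_add
      quotient_smult)

end

section \<open>The product of two algebras\<close>

definition product_algebra ::
  "('k, 'a, 's) module_scheme \<Rightarrow> ('k, 'b, 't) module_scheme \<Rightarrow> ('k, 'a \<times> 'b) module" where
  "product_algebra A B = \<lparr>carrier = carrier A \<times> carrier B,
     monoid.mult = (\<lambda>(a, b) (a', b'). (a \<otimes>\<^bsub>A\<^esub> a', b \<otimes>\<^bsub>B\<^esub> b')), one = (\<one>\<^bsub>A\<^esub>, \<one>\<^bsub>B\<^esub>),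
     zero = (\<zero>\<^bsub>A\<^esub>, \<zero>\<^bsub>B\<^esub>), add = (\<lambda>(a, b) (a', b'). (a \<oplus>\<^bsub>A\<^esub> a', b \<oplus>\<^bsub>B\<^esub> b')),
     smult = (\<lambda>c (a, b). (c \<odot>\<^bsub>A\<^esub> a, c \<odot>\<^bsub>B\<^esub> b))\<rparr>"

lemma nonunital_algebra_product:
  assumes "nonunital_algebra K A" "nonunital_algebra K B"
  shows "nonunital_algebra K (product_algebra A B)"
proof -
  interpret A: nonunital_algebra K A by fact
  interpret B: nonunital_algebra K B by fact
  have "abelian_group (product_algebra A B)"
  proof (rule abelian_groupI)
    fix y assume "y \<in> carrier (product_algebra A B)"
    then show "\<exists>z\<in>carrier (product_algebra A B).
        z \<oplus>\<^bsub>product_algebra A B\<^esub> y = \<zero>\<^bsub>product_algebra A B\<^esub>"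
      by (intro bexI[of _ "(\<ominus>\<^bsub>A\<^esub> fst y, \<ominus>\<^bsub>B\<^esub> snd y)"])
         (auto simp: product_algebra_def A.M.l_neg B.M.l_neg)
  qed (auto simp: product_algebra_def A.M.a_ac B.M.a_ac)
  then have "module K (product_algebra A B)"
    by (rule moduleI[OF A.K.is_cring])
       (auto simp: product_algebra_def A.smult_l_distr A.smult_r_distr A.smult_assoc1
         B.smult_l_distr B.smult_r_distr B.smult_assoc1)
  moreover have "mult_semigroup (product_algebra A B)"
    by (rule mult_semigroup.intro)
       (auto simp: product_algebra_def A.mult_assoc A.mult_closed B.mult_assoc B.mult_closed)
  ultimately show ?thesis
    by (intro nonunital_algebra.intro A.K.field_axioms nonunital_algebra_axioms.intro)
       (auto simp: product_algebra_def A.mult_closed A.mult_distrib_left A.mult_distrib_right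
         A.smult_mult_left A.smult_mult_right B.mult_closed B.mult_distrib_left
         B.mult_distrib_right B.smult_mult_left B.smult_mult_right)
qed


section \<open>Globalizations\<close>

text \<open>Equivariance and reflection concern the underlying sets only, so forgetting the linear
  structure of a globalization leaves a globalization.\<close>

lemma algebra_globalizable_imp_semigroup_globalizable:
  fixes K :: "('k, 'l) ring_scheme" and M :: "('m, 'p) monoid_scheme"
    and X :: "('k, 'a, 's) module_scheme"
  assumes "monoid M" "algebra_partial_action K M X D \<alpha>" "algebra_globalizable K M X D \<alpha>"
  shows "semigroup_globalizable M X D \<alpha>"
proof -
  obtain Y :: "('k, ('m, 'k, 'a) aterm set) module" and \<beta> \<iota>
    where "algebra_globalization K M X D \<alpha> Y \<beta> \<iota>"
    using assms(3) unfolding algebra_globalizable_def by blast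
  then have "semigroup_globalization M X D \<alpha> Y \<beta> \<iota>"
    unfolding algebra_globalization_def semigroup_globalization_def algebra_global_action_def
      semigroup_global_action_def algebra_hom_def
    using algebra_partial_action_imp_semigroup by blast
  \<comment> \<open>The carrier consists of sets of \<open>aterm\<close>s, whereas the semigroup
    notion asks for sets of \<open>sterm\<close>s; \<open>semigroup_globalizableI\<close> bridges
    the two types.\<close>
  then show ?thesis
    using semigroup_globalizableI assms algebra_partial_action_imp_semigroup by metis
qed

section \<open>The kernel of a partial map\<close>

lemma algebra_partial_action_kernel_submodule:
  assumes "algebra_partial_action K M X D \<alpha>" "m \<in> carrier M"
  shows "submodule {d \<in> D m. \<alpha> m d = \<zero>\<^bsub>X\<^esub>} K X" and "\<alpha> m \<zero>\<^bsub>X\<^esub> = \<zero>\<^bsub>X\<^esub>"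
proof -
  interpret X: nonunital_algebra K X
    using assms by (simp add: algebra_partial_action_def)
  have D: "submodule (D m) K X" and h: "\<alpha> m \<in> algebra_hom K (X\<lparr>carrier := D m\<rparr>) X"
    using assms by (auto simp: algebra_partial_action_def algebra_subalgebra_def)
  interpret D: submodule "D m" K X by (fact D)
  have z: "\<zero>\<^bsub>X\<^esub> \<in> D m" using D.one_closed by simp
  \<comment> \<open>With negation written as a scalar multiple, closure of the kernel under
    negatives follows from \<open>smult\<close>.\<close>
  have neg: "\<ominus>\<^bsub>X\<^esub> x = (\<ominus>\<^bsub>K\<^esub> \<one>\<^bsub>K\<^esub>) \<odot>\<^bsub>X\<^esub> x" if "x \<in> carrier X" for x
    using that by (simp add: X.smult_l_minus)
  have smult: "\<alpha> m (c \<odot>\<^bsub>X\<^esub> x) = c \<odot>\<^bsub>X\<^esub> \<alpha> m x" if "c \<in> carrier K" "x \<in> D m" for c x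
    using h that by (auto simp: algebra_hom_def)
  have add: "\<alpha> m (x \<oplus>\<^bsub>X\<^esub> y) = \<alpha> m x \<oplus>\<^bsub>X\<^esub> \<alpha> m y" and closed: "\<alpha> m x \<in> carrier X"
    if "x \<in> D m" "y \<in> D m" for x y
    using h that by (auto simp: algebra_hom_def hom_def)
  show 0: "\<alpha> m \<zero>\<^bsub>X\<^esub> = \<zero>\<^bsub>X\<^esub>"
    using smult[OF X.K.zero_closed z] closed[OF z z] by simp
  show "submodule {d \<in> D m. \<alpha> m d = \<zero>\<^bsub>X\<^esub>} K X"
  proof (rule X.submoduleI)
    fix x assume x: "x \<in> {d \<in> D m. \<alpha> m d = \<zero>\<^bsub>X\<^esub>}"
    then have "\<ominus>\<^bsub>X\<^esub> x = (\<ominus>\<^bsub>K\<^esub> \<one>\<^bsub>K\<^esub>) \<odot>\<^bsub>X\<^esub> x" using D.subset by (intro neg) auto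
    then show "\<ominus>\<^bsub>X\<^esub> x \<in> {d \<in> D m. \<alpha> m d = \<zero>\<^bsub>X\<^esub>}" using x by (simp add: smult)
  qed (use D.subset D.m_closed z 0 in \<open>auto simp: add smult\<close>)
qed

text \<open>The gain from \<open>Y\<close> is that \<open>\<beta> m (\<iota> x)\<close> makes sense
  for every \<open>x\<close> in \<open>X\<close>, even outside \<open>D m\<close>, so a product
  \<open>xk\<close> can be split under \<open>\<beta> m\<close> although \<open>\<alpha> m x\<close>
  may be undefined. The argument works for every monoid and every \<open>m\<close> whose domain is
  an ideal.\<close>

lemma semigroup_globalization_kernel_ideal:
  assumes M: "monoid M" "m \<in> carrier M" and pa: "algebra_partial_action K M X D \<alpha>"
    and id: "algebra_ideal K (D m) X" and gl: "semigroup_globalization M X D \<alpha> Y \<beta> \<iota>"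
  shows "algebra_ideal K {d \<in> D m. \<alpha> m d = \<zero>\<^bsub>X\<^esub>} X"
proof -
  interpret M: monoid M by fact
  interpret X: nonunital_algebra K X
    using pa by (simp add: algebra_partial_action_def)
  interpret D: submodule "D m" K X
    using id by (simp add: algebra_ideal_def)
  have z: "\<zero>\<^bsub>X\<^esub> \<in> D m" using D.one_closed by simp
  note 0 = algebra_partial_action_kernel_submodule(2)[OF pa M(2)]
  have spa: "strong_partial_action M (carrier X) D \<alpha>"
    using pa by (simp add: algebra_partial_action_def)
  have ih: "\<And>x y. x \<in> carrier X \<Longrightarrow> y \<in> carrier X \<Longrightarrow> \<iota> (x \<otimes>\<^bsub>X\<^esub> y) = \<iota> x \<otimes>\<^bsub>Y\<^esub> \<iota> y"
    and ic: "\<And>x. x \<in> carrier X \<Longrightarrow> \<iota> x \<in> carrier Y"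
    and bh: "\<And>y z. y \<in> carrier Y \<Longrightarrow> z \<in> carrier Y \<Longrightarrow> \<beta> m (y \<otimes>\<^bsub>Y\<^esub> z) = \<beta> m y \<otimes>\<^bsub>Y\<^esub> \<beta> m z"
    and eq: "\<And>x. x \<in> D m \<Longrightarrow> \<beta> m (\<iota> x) = \<iota> (\<alpha> m x)"
    using gl M(2) unfolding semigroup_globalization_def semigroup_global_action_def
      semigroup_partial_action_def equivariant_def by (auto simp: hom_def)
  have b1: "\<beta> \<one>\<^bsub>M\<^esub> y = y" if "y \<in> carrier Y" for y
    using gl that unfolding semigroup_globalization_def semigroup_global_action_def
      semigroup_partial_action_def strong_partial_action_def by blast
  \<comment> \<open>Reflection at the identity of \<open>M\<close>: \<open>\<beta> \<one>\<close>
    fixes \<open>\<iota> x = \<iota> y\<close>, whence \<open>\<alpha> \<one> x = y\<close>.\<close>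
  have inj: "x = y" if "x \<in> carrier X" "y \<in> carrier X" "\<iota> x = \<iota> y" for x y
  proof -
    have "\<alpha> \<one>\<^bsub>M\<^esub> x = y"
      using gl that b1[OF ic] M.one_closed
      unfolding semigroup_globalization_def reflects_action_def by metis
    then show ?thesis using spa that by (simp add: strong_partial_action_def)
  qed
  have DX: "\<alpha> m d \<in> carrier X" "d \<in> carrier X" if "d \<in> D m" for d
    using spa M(2) that by (auto simp: strong_partial_action_def)
  have "x \<otimes>\<^bsub>X\<^esub> k \<in> D m \<and> \<alpha> m (x \<otimes>\<^bsub>X\<^esub> k) = \<zero>\<^bsub>X\<^esub> \<and> k \<otimes>\<^bsub>X\<^esub> x \<in> D m \<and> \<alpha> m (k \<otimes>\<^bsub>X\<^esub> x) = \<zero>\<^bsub>X\<^esub>"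
    if x: "x \<in> carrier X" and k: "k \<in> D m" "\<alpha> m k = \<zero>\<^bsub>X\<^esub>" for x k
  proof -
    have D: "x \<otimes>\<^bsub>X\<^esub> k \<in> D m" "k \<otimes>\<^bsub>X\<^esub> x \<in> D m"
      using id x k by (auto simp: algebra_ideal_def)
    \<comment> \<open>After \<open>\<beta> m \<circ> \<iota>\<close>, the elements \<open>k\<close>
      and zero are indistinguishable, so \<open>k\<close> can be replaced by zero in both products
      below.\<close>
    have e: "\<beta> m (\<iota> k) = \<beta> m (\<iota> \<zero>\<^bsub>X\<^esub>)" using k z by (simp add: eq 0)
    have "\<iota> (\<alpha> m (x \<otimes>\<^bsub>X\<^esub> k)) = \<beta> m (\<iota> x) \<otimes>\<^bsub>Y\<^esub> \<beta> m (\<iota> \<zero>\<^bsub>X\<^esub>)"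
      using D k x DX e by (simp flip: eq add: ih bh ic)
    also have "\<dots> = \<beta> m (\<iota> (x \<otimes>\<^bsub>X\<^esub> \<zero>\<^bsub>X\<^esub>))"
      using x by (simp only: ih bh ic X.M.zero_closed)
    also have "\<dots> = \<iota> \<zero>\<^bsub>X\<^esub>" using x z by (simp add: X.mult_zero eq 0)
    finally have l: "\<alpha> m (x \<otimes>\<^bsub>X\<^esub> k) = \<zero>\<^bsub>X\<^esub>" using inj DX D by auto
    have "\<iota> (\<alpha> m (k \<otimes>\<^bsub>X\<^esub> x)) = \<beta> m (\<iota> \<zero>\<^bsub>X\<^esub>) \<otimes>\<^bsub>Y\<^esub> \<beta> m (\<iota> x)"
      using D k x DX e by (simp flip: eq add: ih bh ic)
    also have "\<dots> = \<beta> m (\<iota> (\<zero>\<^bsub>X\<^esub> \<otimes>\<^bsub>X\<^esub> x))"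
      using x by (simp only: ih bh ic X.M.zero_closed)
    also have "\<dots> = \<iota> \<zero>\<^bsub>X\<^esub>" using x z by (simp add: X.mult_zero eq 0)
    finally have "\<alpha> m (k \<otimes>\<^bsub>X\<^esub> x) = \<zero>\<^bsub>X\<^esub>" using inj DX D by auto
    with D l show ?thesis by blast
  qed
  then show ?thesis
    using algebra_partial_action_kernel_submodule(1)[OF pa M(2)] by (auto simp: algebra_ideal_def)
qed

section \<open>An algebra globalization from two quotients\<close>

lemma kernel_ideal_imp_algebra_globalizable:
  fixes K :: "('k, 'l) ring_scheme" and X :: "('k, 'a, 's) module_scheme"
  assumes pa: "algebra_partial_action K zero_one_monoid X D \<alpha>"
    and I: "algebra_ideal K (\<alpha> 0 ` D 0) X"
    and N: "algebra_ideal K {d \<in> D 0. \<alpha> 0 d = \<zero>\<^bsub>X\<^esub>} X"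
  shows "algebra_globalizable K zero_one_monoid X D \<alpha>"
proof -
  define N' I' where "N' = {d \<in> D 0. \<alpha> 0 d = \<zero>\<^bsub>X\<^esub>}" and "I' = \<alpha> 0 ` D 0"
  have aX: "nonunital_algebra K X" and spa: "strong_partial_action zero_one_monoid (carrier X) D \<alpha>"
    using pa by (simp_all add: algebra_partial_action_def)
  interpret X: nonunital_algebra K X by (fact aX)
  have idN: "algebra_ideal K N' X" and idI: "algebra_ideal K I' X"
    using N I by (simp_all add: N'_def I'_def)
  have M: "carrier zero_one_monoid = {0, 1}" "\<one>\<^bsub>zero_one_monoid\<^esub> = 1"
    "\<And>m n. m \<otimes>\<^bsub>zero_one_monoid\<^esub> n = m * n"
    by (simp_all add: zero_one_monoid_def)
  have D1: "D 1 = carrier X" "\<And>x. x \<in> carrier X \<Longrightarrow> \<alpha> 1 x = x"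
    and DX: "\<And>x. x \<in> D 0 \<Longrightarrow> x \<in> carrier X" "\<And>x. x \<in> D 0 \<Longrightarrow> \<alpha> 0 x \<in> carrier X"
    and c: "{x \<in> D 0. \<alpha> 0 x \<in> D 0} = D (0 * 0) \<inter> D 0"
    and i: "\<And>x. x \<in> D 0 \<Longrightarrow> \<alpha> 0 x \<in> D 0 \<Longrightarrow> \<alpha> 0 (\<alpha> 0 x) = \<alpha> (0 * 0) x"
    using spa unfolding strong_partial_action_def M by auto
  \<comment> \<open>Since \<open>0 * 0 = 0\<close>, condition \<open>c\<close> says that
    \<open>\<alpha> 0\<close> maps \<open>D 0\<close> into itself, and \<open>i\<close> then says
    that it is idempotent.\<close>
  have idem: "\<alpha> 0 x \<in> D 0" "\<alpha> 0 (\<alpha> 0 x) = \<alpha> 0 x" if "x \<in> D 0" for x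
  proof -
    show "\<alpha> 0 x \<in> D 0" using c that by auto
    then show "\<alpha> 0 (\<alpha> 0 x) = \<alpha> 0 x" using i[OF that] by simp
  qed
  interpret D: submodule "D 0" K X
    using pa by (simp add: algebra_partial_action_def algebra_subalgebra_def M)
  have h: "\<alpha> 0 \<in> algebra_hom K (X\<lparr>carrier := D 0\<rparr>) X"
    using pa by (simp add: algebra_partial_action_def M)
  have add: "\<alpha> 0 (x \<oplus>\<^bsub>X\<^esub> y) = \<alpha> 0 x \<oplus>\<^bsub>X\<^esub> \<alpha> 0 y" if "x \<in> D 0" "y \<in> D 0" for x y
    using h that by (auto simp: algebra_hom_def hom_def)
  have minus_add: "(x \<ominus>\<^bsub>X\<^esub> y) \<oplus>\<^bsub>X\<^esub> y = x" if "x \<in> carrier X" "y \<in> carrier X" for x y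
    using that by (simp add: a_minus_def X.M.a_assoc X.M.l_neg)
  \<comment> \<open>On its domain, \<open>\<alpha> 0\<close> is the projection onto
    \<open>I'\<close> along \<open>N'\<close>; the decomposition \<open>x = (x - y) + y\<close>
    gives both directions.\<close>
  have graph: "x \<ominus>\<^bsub>X\<^esub> y \<in> N' \<and> y \<in> I' \<longleftrightarrow> x \<in> D 0 \<and> \<alpha> 0 x = y"
    if x: "x \<in> carrier X" and y: "y \<in> carrier X" for x y
  proof
    assume xy: "x \<ominus>\<^bsub>X\<^esub> y \<in> N' \<and> y \<in> I'"
    then have d: "x \<ominus>\<^bsub>X\<^esub> y \<in> D 0" "\<alpha> 0 (x \<ominus>\<^bsub>X\<^esub> y) = \<zero>\<^bsub>X\<^esub>" "y \<in> D 0" "\<alpha> 0 y = y"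
      using idem by (auto simp: N'_def I'_def)
    then show "x \<in> D 0 \<and> \<alpha> 0 x = y"
      using D.m_closed[of "x \<ominus>\<^bsub>X\<^esub> y" y] add[of "x \<ominus>\<^bsub>X\<^esub> y" y] minus_add[OF x y] y by simp
  next
    assume xy: "x \<in> D 0 \<and> \<alpha> 0 x = y"
    then have yD: "y \<in> D 0" "\<alpha> 0 y = y" using idem by auto
    then have d: "x \<ominus>\<^bsub>X\<^esub> y \<in> D 0"
      using xy X.submoduleE(5,6)[OF D.submodule_axioms] by (auto simp: a_minus_def)
    \<comment> \<open>Additivity on \<open>x = (x - y) + y\<close>, where \<open>y\<close> is fixed
      by \<open>\<alpha> 0\<close>; cancelling \<open>y\<close> puts \<open>x - y\<close> into the
      kernel.\<close>
    have "y = \<alpha> 0 (x \<ominus>\<^bsub>X\<^esub> y) \<oplus>\<^bsub>X\<^esub> y"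
      using add[OF d yD(1)] minus_add[OF x y] xy yD by simp
    then have "\<alpha> 0 (x \<ominus>\<^bsub>X\<^esub> y) = \<zero>\<^bsub>X\<^esub>"
      using DX(2)[OF d] y by (metis X.M.add.r_cancel_one')
    then show "x \<ominus>\<^bsub>X\<^esub> y \<in> N' \<and> y \<in> I'"
      using d xy by (auto simp: N'_def I'_def)
  qed

  let ?A = "quotient_algebra X N'" and ?B = "quotient_algebra X I'"
  define Y where "Y = product_algebra ?A ?B"
  \<comment> \<open>Zero acts by the idempotent endomorphism that kills the second coordinate. Every
    other natural number acts as the identity, so \<open>\<beta> m\<close> is an endomorphism for
    all \<open>m\<close>.\<close>
  define \<beta> :: "nat \<Rightarrow> 'a set \<times> 'a set \<Rightarrow> 'a set \<times> 'a set"
    where "\<beta> m = (\<lambda>(a, b). if m = 0 then (a, \<zero>\<^bsub>?B\<^esub>) else (a, b))" for m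
  define \<iota> where "\<iota> x = (N' +>\<^bsub>X\<^esub> x, I' +>\<^bsub>X\<^esub> x)" for x
  have aA: "nonunital_algebra K ?A" and aB: "nonunital_algebra K ?B"
    using nonunital_algebra_quotient aX idN idI by blast+
  interpret A: nonunital_algebra K ?A by (fact aA)
  interpret B: nonunital_algebra K ?B by (fact aB)
  have aY: "nonunital_algebra K Y"
    unfolding Y_def by (rule nonunital_algebra_product[OF aA aB])
  interpret Y: nonunital_algebra K Y by (fact aY)
  have "strong_partial_action zero_one_monoid (carrier Y) (\<lambda>m. carrier Y) \<beta>"
    by (auto simp: strong_partial_action_def M \<beta>_def Y_def product_algebra_def)
  moreover have "\<beta> m \<in> algebra_hom K Y Y" for m
    by (auto simp: algebra_hom_def hom_def \<beta>_def Y_def product_algebra_def A.mult_closed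
        B.mult_closed B.mult_zero)
  moreover have "algebra_subalgebra K (carrier Y) Y"
    using Y.carrier_is_submodule Y.mult_closed by (auto simp: algebra_subalgebra_def subsemigroup_def)
  ultimately have global: "algebra_global_action K zero_one_monoid Y \<beta>"
    by (simp add: algebra_global_action_def algebra_partial_action_def aY)
  have hom: "\<iota> \<in> algebra_hom K X Y"
    using coset_algebra_hom[OF aX idN] coset_algebra_hom[OF aX idI]
    by (auto simp: algebra_hom_def hom_def \<iota>_def Y_def product_algebra_def)
  \<comment> \<open>First coordinates agree iff \<open>x - y\<close> is in \<open>N'\<close>. The
    second coordinate on the left is the zero coset \<open>I'\<close>, which equals
    \<open>I' + y\<close> iff \<open>y\<close> is in \<open>I'\<close>. With \<open>graph\<close>,
    this single equivalence yields both equivariance and reflection at zero.\<close>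
  have \<beta>0: "\<beta> 0 (\<iota> x) = \<iota> y \<longleftrightarrow> x \<in> D 0 \<and> \<alpha> 0 x = y"
    if "x \<in> carrier X" "y \<in> carrier X" for x y
  proof -
    have "\<zero>\<^bsub>?B\<^esub> = I'" by (simp add: quotient_algebra_def)
    then show ?thesis
      using that coset_eq_iff[OF aX idN] coset_eq_ideal_iff[OF aX idI, of y] graph[of x y]
      by (simp add: \<beta>_def \<iota>_def eq_commute[of I'])
  qed
  have \<beta>1: "\<beta> 1 y = y" for y
    by (cases y) (simp add: \<beta>_def)
  \<comment> \<open>This is reflection at \<open>1\<close>, and amounts to \<open>N'\<close> and
    \<open>I'\<close> meeting only in zero: an element of \<open>I'\<close> is fixed by
    \<open>\<alpha> 0\<close>, an element of \<open>N'\<close> is killed by it.\<close>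
  have inj: "x = y" if "x \<in> carrier X" "y \<in> carrier X" "\<iota> x = \<iota> y" for x y
  proof -
    have d: "x \<ominus>\<^bsub>X\<^esub> y \<in> N'" "x \<ominus>\<^bsub>X\<^esub> y \<in> I'"
      using that coset_eq_iff[OF aX idN] coset_eq_iff[OF aX idI] by (auto simp: \<iota>_def)
    from d(2) obtain w where "w \<in> D 0" "x \<ominus>\<^bsub>X\<^esub> y = \<alpha> 0 w" by (auto simp: I'_def)
    then have "x \<ominus>\<^bsub>X\<^esub> y = \<zero>\<^bsub>X\<^esub>" using idem(2)[of w] d(1) by (simp add: N'_def)
    then show ?thesis using minus_add[OF that(1,2)] that by simp
  qed
  have "equivariant zero_one_monoid D \<alpha> \<beta> \<iota>"
    unfolding equivariant_def M using \<beta>0 \<beta>1 D1 DX by simp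
  moreover have "reflects_action zero_one_monoid (carrier X) D \<alpha> \<beta> \<iota>"
    unfolding reflects_action_def M using \<beta>0 \<beta>1 D1 inj by simp
  ultimately have "algebra_globalization K zero_one_monoid X D \<alpha> Y \<beta> \<iota>"
    using global hom by (simp add: algebra_globalization_def)
  then show ?thesis
    by (rule algebra_globalizableI[OF monoid_zero_one_monoid pa])
qed

theorem corollary4p5:
  fixes K :: "('k, 'l) ring_scheme"
    and X :: "('k, 'a, 's) module_scheme"
    and D :: "nat \<Rightarrow> 'a set"
    and \<alpha> :: "nat \<Rightarrow> 'a \<Rightarrow> 'a"
  assumes "field K"
    and "nonunital_algebra K X"
    and "algebra_partial_action K zero_one_monoid X D \<alpha>"
    and "algebra_ideal K (D 0) X"
    and "algebra_ideal K (\<alpha> 0 ` D 0) X"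
  shows "algebra_globalizable K zero_one_monoid X D \<alpha> \<longleftrightarrow>
    semigroup_globalizable zero_one_monoid X D \<alpha>"
proof
  assume "algebra_globalizable K zero_one_monoid X D \<alpha>"
  then show "semigroup_globalizable zero_one_monoid X D \<alpha>"
    by (rule algebra_globalizable_imp_semigroup_globalizable[OF monoid_zero_one_monoid assms(3)])
next
  assume "semigroup_globalizable zero_one_monoid X D \<alpha>"
  then obtain Y :: "(nat, 'a) sterm set monoid" and \<beta> \<iota>
    where gl: "semigroup_globalization zero_one_monoid X D \<alpha> Y \<beta> \<iota>"
    unfolding semigroup_globalizable_def by blast
  have "(0 :: nat) \<in> carrier zero_one_monoid" by (simp add: zero_one_monoid_def)
  \<comment> \<open>That \<open>D 0\<close> is an ideal makes the kernel an ideal; that the image is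
    one allows the quotient by it.\<close>
  from semigroup_globalization_kernel_ideal[OF monoid_zero_one_monoid this assms(3,4) gl] assms(3,5)
  show "algebra_globalizable K zero_one_monoid X D \<alpha>"
    by (intro kernel_ideal_imp_algebra_globalizable)
qed

end
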